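(* Let $(X,d,\mu)$ be a space of homogeneous type and $m\ge 1$ an integer. Let $p_i(\cdot)\in\mathscr P$, $i=1,\dots,m$, with $\frac1{p(\cdot)}=\sum_{i=1}^m\frac1{p_i(\cdot)}$, let $q(\cdot)\in\mathscr P_0$ and let $\eta\in[0,m)$ be a constant with $\frac1{p(\cdot)}-\frac1{q(\cdot)}=\eta$. Let $\vec\omega=(\omega_1,\dots,\omega_m,\omega)$ be a multiple weight. Then the operators $\mathscr A_{\eta,B}$ are bounded from $L^{p_1(\cdot)}(X,\omega_1)\times\cdots\times L^{p_m(\cdot)}(X,\omega_m)$ to $WL^{q(\cdot)}(X,\omega)$ uniformly for all balls $B\subseteq X$ if and only if $\vec\omega\in A_{\vec p(\cdot),q(\cdot)}(X)$. Furthermore, $$[\vec\omega]_{A_{\vec p(\cdot),q(\cdot)}(X)}\le C\,\sup_{B}\|\mathscr A_{\eta,B}\|_{\prod_{i=1}^m L^{p_i(\cdot)}(X,\omega_i)\to WL^{q(\cdot)}(X,\omega)}\quad\text{and}\quad \sup_{B}\|\mathscr A_{\eta,B}\|_{\prod_{i=1}^m L^{p_i(\cdot)}(X,\omega_i)\to WL^{q(\cdot)}(X,\omega)}\le[\vec\omega]_{A_{\vec p(\cdot),q(\cdot)}(X)},$$ where the supremum is over all balls $B\subseteq X$ and the constant $C$ is independent of $\vec\omega$.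
   Context: Space of homogeneous type: a nonempty set $X$ with a quasi-metric $d:X\times X\to[0,\infty)$ (i.e. $d(x,y)=0$ when $x=y$, $d(x,y)=d(y,x)$, and $d(x,y)\le A_0(d(x,z)+d(z,y))$ for some constant $A_0\ge1$) and a regular measure $\mu$ on the $\sigma$-algebra generated by open sets and quasi-metric balls $B(x,r)$, which is doubling: $0<\mu(B(x,2r))\le C_\mu\,\mu(B(x,r))<\infty$ for all $x\in X$, $r>0$. Exponents: for measurable $p(\cdot)$ on $X$, $p_-=\operatorname{ess\,inf}_X p$, $p_+=\operatorname{ess\,sup}_X p$. $\mathscr P$ is the set of measurable $p(\cdot):X\to[1,\infty)$ with $1<p_-\le p_+<\infty$; $\mathscr P_0$ is the set of measurable $p(\cdot):X\to(0,\infty)$ with $0<p_-\le p_+<\infty$. The conjugate exponent is $p'(\cdot)=p(\cdot)/(p(\cdot)-1)$. Norms: for $p(\cdot)\in\mathscr P_0$, $\|f\|_{L^{p(\cdot)}}=\|f\|_{p(\cdot)}=\inf\{\lambda>0:\int_X|f(x)/\lambda|^{p(x)}d\mu\le1\}$, $\|f\|_{L^{p(\cdot)}(X,\omega)}=\|\omega f\|_{p(\cdot)}$, and $\|f\|_{WL^{q(\cdot)}(X,\omega)}=\sup_{t>0}\|t\,\omega\,\chi_{\{x\in X:|f(x)|>t\}}\|_{q(\cdot)}$. Weights: a weight is a locally integrable $\omega:X\to[0,\infty]$ with $0<\omega<\infty$ a.e.; a multiple weight $\vec\omega=(\omega_1,\dots,\omega_m,\omega)$ is a tuple of weights. $\vec\omega\in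 A_{\vec p(\cdot),q(\cdot)}(X)$ means $$[\vec\omega]_{A_{\vec p(\cdot),q(\cdot)}(X)}:=\sup_{B\subseteq X}\mu(B)^{\eta-m}\|\omega\chi_B\|_{q(\cdot)}\prod_{i=1}^m\|\omega_i^{-1}\chi_B\|_{p_i'(\cdot)}<\infty,$$ the supremum being over all balls $B$. Operator: for a ball $B$ and $\vec f=(f_1,\dots,f_m)$, $\mathscr A_{\eta,B}(\vec f)(x)=\mu(B)^\eta\Big(\prod_{i=1}^m\frac1{\mu(B)}\int_B|f_i|\,d\mu\Big)\chi_B(x)$. The operator norm is the least $C\ge 0$ (possibly $\infty$) with $\|\mathscr A_{\eta,B}(\vec f)\|_{WL^{q(\cdot)}(X,\omega)}\le C\prod_i\|f_i\|_{L^{p_i(\cdot)}(X,\omega_i)}$.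
   Formalization: The second norm inequality is proved with the extra factor ∏(1+1/(p_i)_- − 1/(p_i)_+) before the weight constant, since with constant 1 it fails for some non-constant exponents (already on a two-point space); the factor is 1 when all p_i are constant. *)

theory Defs
  imports "HOL-Analysis.Analysis" "HOL-Probability.Essential_Supremum"
begin

section \<open>Spaces of homogeneous type\<close>

definition quasi_metric_on :: "'a set \<Rightarrow> ('a \<Rightarrow> 'a \<Rightarrow> real) \<Rightarrow> bool" where
  "quasi_metric_on X d \<longleftrightarrow>
     (\<forall>x\<in>X. \<forall>y\<in>X. 0 \<le> d x y) \<and>
     (\<forall>x\<in>X. d x x = 0) \<and>
     (\<forall>x\<in>X. \<forall>y\<in>X. d x y = d y x) \<and>
     (\<exists>A0\<ge>1. \<forall>x\<in>X. \<forall>y\<in>X. \<forall>z\<in>X. d x y \<le> A0 * (d x z + d z y))"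

definition qball :: "'a set \<Rightarrow> ('a \<Rightarrow> 'a \<Rightarrow> real) \<Rightarrow> 'a \<Rightarrow> real \<Rightarrow> 'a set" where
  "qball X d x r = {y \<in> X. d x y < r}"

definition qballs :: "'a set \<Rightarrow> ('a \<Rightarrow> 'a \<Rightarrow> real) \<Rightarrow> 'a set set" where
  "qballs X d = {B. \<exists>x\<in>X. \<exists>r>0. B = qball X d x r}"

text \<open>The balls of a quasi-metric need not be open in the topology that it induces; this is why the
  \<open>\<sigma>\<close>-algebra below is generated by the open sets together with the balls.\<close>

definition qtopology :: "'a set \<Rightarrow> ('a \<Rightarrow> 'a \<Rightarrow> real) \<Rightarrow> 'a topology" where
  "qtopology X d = topology (\<lambda>U. U \<subseteq> X \<and> (\<forall>x\<in>U. \<exists>r>0. qball X d x r \<subseteq> U))"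

lemma openin_qtopology:
  "openin (qtopology X d) U \<longleftrightarrow> U \<subseteq> X \<and> (\<forall>x\<in>U. \<exists>r>0. qball X d x r \<subseteq> U)"
proof -
  let ?P = "\<lambda>U. U \<subseteq> X \<and> (\<forall>x\<in>U. \<exists>r>0. qball X d x r \<subseteq> U)"
  have inter: "?P (S \<inter> T)" if S: "?P S" and T: "?P T" for S T
  proof (intro conjI ballI)
    show "S \<inter> T \<subseteq> X" using S by blast
    fix x assume x: "x \<in> S \<inter> T"
    obtain r s where r: "r > 0" "qball X d x r \<subseteq> S" and s: "s > 0" "qball X d x s \<subseteq> T"
      using S T x by blast
    have "qball X d x (min r s) \<subseteq> S \<inter> T"
      using r s by (auto simp: qball_def)
    then show "\<exists>r>0. qball X d x r \<subseteq> S \<inter> T"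
      using r s by (intro exI[of _ "min r s"]) auto
  qed
  have union: "?P (\<Union>\<K>)" if "\<forall>K\<in>\<K>. ?P K" for \<K>
  proof (intro conjI ballI)
    show "\<Union>\<K> \<subseteq> X" using that by blast
    fix x assume "x \<in> \<Union>\<K>"
    then obtain K where K: "K \<in> \<K>" "x \<in> K" by blast
    then have "?P K" using that by simp
    then obtain r where "r > 0" "qball X d x r \<subseteq> K" using K(2) by blast
    then show "\<exists>r>0. qball X d x r \<subseteq> \<Union>\<K>" using K by blast
  qed
  have "istopology ?P"
    unfolding istopology_def using inter union by presburger
  then show ?thesis
    by (simp add: qtopology_def)
qed

text \<open>Outer regularity by open sets, and inner regularity of open sets by compact sets. A compact
  set need not be measurable, as no separation is imposed on the topology.\<close>

definition regular_measure :: "'a topology \<Rightarrow> 'a measure \<Rightarrow> bool" where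
  "regular_measure T M \<longleftrightarrow>
     (\<forall>E\<in>sets M. emeasure M E = (INF U\<in>{U. openin T U \<and> E \<subseteq> U}. emeasure M U)) \<and>
     (\<forall>U. openin T U \<longrightarrow>
        emeasure M U = (SUP K\<in>{K \<in> sets M. compactin T K \<and> K \<subseteq> U}. emeasure M K))"

definition doubling_measure :: "'a set \<Rightarrow> ('a \<Rightarrow> 'a \<Rightarrow> real) \<Rightarrow> 'a measure \<Rightarrow> bool" where
  "doubling_measure X d M \<longleftrightarrow>
     (\<exists>C::real. \<forall>x\<in>X. \<forall>r>0.
        0 < emeasure M (qball X d x (2 * r)) \<and>
        emeasure M (qball X d x (2 * r)) \<le> ennreal C * emeasure M (qball X d x r) \<and>
        ennreal C * emeasure M (qball X d x r) < \<infinity>)"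

definition homogeneous_type :: "'a set \<Rightarrow> ('a \<Rightarrow> 'a \<Rightarrow> real) \<Rightarrow> 'a measure \<Rightarrow> bool" where
  "homogeneous_type X d M \<longleftrightarrow>
     X \<noteq> {} \<and> quasi_metric_on X d \<and>
     space M = X \<and> sets M = sigma_sets X ({U. openin (qtopology X d) U} \<union> qballs X d) \<and>
     regular_measure (qtopology X d) M \<and> doubling_measure X d M"

section \<open>Variable exponents\<close>

definition exp_plus :: "'a measure \<Rightarrow> ('a \<Rightarrow> real) \<Rightarrow> ereal" where
  "exp_plus M p = esssup M (\<lambda>x. ereal (p x))"

definition exp_minus :: "'a measure \<Rightarrow> ('a \<Rightarrow> real) \<Rightarrow> ereal" where
  "exp_minus M p = - esssup M (\<lambda>x. - ereal (p x))"

definition exponents :: "'a measure \<Rightarrow> ('a \<Rightarrow> real) set" where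
  "exponents M = {p. p \<in> borel_measurable M \<and> (\<forall>x\<in>space M. 1 \<le> p x) \<and>
     1 < exp_minus M p \<and> exp_minus M p \<le> exp_plus M p \<and> exp_plus M p < \<infinity>}"

definition exponents0 :: "'a measure \<Rightarrow> ('a \<Rightarrow> real) set" where
  "exponents0 M = {p. p \<in> borel_measurable M \<and> (\<forall>x\<in>space M. 0 < p x) \<and>
     0 < exp_minus M p \<and> exp_minus M p \<le> exp_plus M p \<and> exp_plus M p < \<infinity>}"

definition conj_exp :: "('a \<Rightarrow> real) \<Rightarrow> 'a \<Rightarrow> real" where
  "conj_exp p x = p x / (p x - 1)"

text \<open>The constant of the generalized Hoelder inequality
  \<open>\<integral>|f g| \<le> K \<parallel>f\<parallel>\<^sub>p \<parallel>g\<parallel>\<^sub>p'\<close> for Luxemburg norms, \<open>K = 1/p\<^sub>- + 1/(p')\<^sub>-\<close>. One has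
  \<open>1 \<le> K < 2\<close>, with \<open>K = 1\<close> iff \<open>p\<close> is a.e. constant.\<close>

definition holder_const :: "'a measure \<Rightarrow> ('a \<Rightarrow> real) \<Rightarrow> real" where
  "holder_const M p = 1 + 1 / real_of_ereal (exp_minus M p) - 1 / real_of_ereal (exp_plus M p)"

section \<open>Variable Lebesgue norms\<close>

text \<open>The norms only depend on absolute values, so they are defined for functions with values in
  \<open>[0,\<infinity>]\<close>; this accommodates weights and their inverses. The power below is meant for positive
  exponents, as \<open>\<infinity>\<close> is mapped to \<open>\<infinity>\<close>.\<close>

definition epow :: "ennreal \<Rightarrow> real \<Rightarrow> ennreal" where
  "epow a s = (if a = \<infinity> then \<infinity> else ennreal (enn2real a powr s))"

definition vnorm :: "'a measure \<Rightarrow> ('a \<Rightarrow> real) \<Rightarrow> ('a \<Rightarrow> ennreal) \<Rightarrow> ennreal" where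
  "vnorm M p f = Inf {ennreal l |l. l > 0 \<and> (\<integral>\<^sup>+x. epow (f x / ennreal l) (p x) \<partial>M) \<le> 1}"

definition wnorm :: "'a measure \<Rightarrow> ('a \<Rightarrow> real) \<Rightarrow> ('a \<Rightarrow> ennreal) \<Rightarrow> ('a \<Rightarrow> ennreal) \<Rightarrow> ennreal" where
  "wnorm M p w f = vnorm M p (\<lambda>x. w x * f x)"

definition weak_norm :: "'a measure \<Rightarrow> ('a \<Rightarrow> real) \<Rightarrow> ('a \<Rightarrow> ennreal) \<Rightarrow> ('a \<Rightarrow> ennreal) \<Rightarrow> ennreal" where
  "weak_norm M q w f =
     (SUP t\<in>{0<..}. vnorm M q (\<lambda>x. ennreal t * w x * indicator {y \<in> space M. f y > ennreal t} x))"

definition Lspace :: "'a measure \<Rightarrow> ('a \<Rightarrow> real) \<Rightarrow> ('a \<Rightarrow> ennreal) \<Rightarrow> ('a \<Rightarrow> real) set" where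
  "Lspace M p w = {f. f \<in> borel_measurable M \<and> wnorm M p w (\<lambda>x. ennreal \<bar>f x\<bar>) < \<infinity>}"

section \<open>Weights\<close>

text \<open>Local integrability means integrability over balls.\<close>

definition weight :: "'a set \<Rightarrow> ('a \<Rightarrow> 'a \<Rightarrow> real) \<Rightarrow> 'a measure \<Rightarrow> ('a \<Rightarrow> ennreal) \<Rightarrow> bool" where
  "weight X d M w \<longleftrightarrow> w \<in> borel_measurable M \<and>
     (\<forall>B\<in>qballs X d. (\<integral>\<^sup>+x. w x * indicator B x \<partial>M) < \<infinity>) \<and>
     (AE x in M. 0 < w x \<and> w x < \<infinity>)"

definition A_const :: "'a set \<Rightarrow> ('a \<Rightarrow> 'a \<Rightarrow> real) \<Rightarrow> 'a measure \<Rightarrow> nat \<Rightarrow> real \<Rightarrow>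
    (nat \<Rightarrow> 'a \<Rightarrow> real) \<Rightarrow> ('a \<Rightarrow> real) \<Rightarrow> (nat \<Rightarrow> 'a \<Rightarrow> ennreal) \<Rightarrow> ('a \<Rightarrow> ennreal) \<Rightarrow> ennreal" where
  "A_const X d M m \<eta> p q ws w =
     (SUP B\<in>qballs X d. ennreal (measure M B powr (\<eta> - real m)) *
        vnorm M q (\<lambda>x. w x * indicator B x) *
        (\<Prod>i=1..m. vnorm M (conj_exp (p i)) (\<lambda>x. inverse (ws i x) * indicator B x)))"

definition A_class :: "'a set \<Rightarrow> ('a \<Rightarrow> 'a \<Rightarrow> real) \<Rightarrow> 'a measure \<Rightarrow> nat \<Rightarrow> real \<Rightarrow>
    (nat \<Rightarrow> 'a \<Rightarrow> real) \<Rightarrow> ('a \<Rightarrow> real) \<Rightarrow> (nat \<Rightarrow> 'a \<Rightarrow> ennreal) \<Rightarrow> ('a \<Rightarrow> ennreal) \<Rightarrow> bool" where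
  "A_class X d M m \<eta> p q ws w \<longleftrightarrow> A_const X d M m \<eta> p q ws w < \<infinity>"

section \<open>The averaging operators\<close>

text \<open>The averages are Lebesgue integrals in \<open>[0,\<infinity>]\<close>, so that a divergent average is \<open>\<infinity>\<close>
  (and not \<open>0\<close>, as it would be for the Bochner integral).\<close>

definition avg_op :: "'a measure \<Rightarrow> nat \<Rightarrow> real \<Rightarrow> 'a set \<Rightarrow> (nat \<Rightarrow> 'a \<Rightarrow> real) \<Rightarrow> 'a \<Rightarrow> ennreal" where
  "avg_op M m \<eta> B f x = ennreal (measure M B powr \<eta>) *
     (\<Prod>i=1..m. (\<integral>\<^sup>+y. ennreal \<bar>f i y\<bar> * indicator B y \<partial>M) / emeasure M B) * indicator B x"

definition avg_op_bound :: "'a measure \<Rightarrow> nat \<Rightarrow> real \<Rightarrow> (nat \<Rightarrow> 'a \<Rightarrow> real) \<Rightarrow> ('a \<Rightarrow> real) \<Rightarrow>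
    (nat \<Rightarrow> 'a \<Rightarrow> ennreal) \<Rightarrow> ('a \<Rightarrow> ennreal) \<Rightarrow> 'a set \<Rightarrow> ennreal \<Rightarrow> bool" where
  "avg_op_bound M m \<eta> p q ws w B C \<longleftrightarrow>
     (\<forall>f. (\<forall>i\<in>{1..m}. f i \<in> Lspace M (p i) (ws i)) \<longrightarrow>
        weak_norm M q w (avg_op M m \<eta> B f) \<le>
          C * (\<Prod>i=1..m. wnorm M (p i) (ws i) (\<lambda>x. ennreal \<bar>f i x\<bar>)))"

definition avg_op_norm :: "'a measure \<Rightarrow> nat \<Rightarrow> real \<Rightarrow> (nat \<Rightarrow> 'a \<Rightarrow> real) \<Rightarrow> ('a \<Rightarrow> real) \<Rightarrow>
    (nat \<Rightarrow> 'a \<Rightarrow> ennreal) \<Rightarrow> ('a \<Rightarrow> ennreal) \<Rightarrow> 'a set \<Rightarrow> ennreal" where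
  "avg_op_norm M m \<eta> p q ws w B = Inf {C. avg_op_bound M m \<eta> p q ws w B C}"

definition uniformly_bounded_avg_ops :: "'a set \<Rightarrow> ('a \<Rightarrow> 'a \<Rightarrow> real) \<Rightarrow> 'a measure \<Rightarrow> nat \<Rightarrow> real \<Rightarrow>
    (nat \<Rightarrow> 'a \<Rightarrow> real) \<Rightarrow> ('a \<Rightarrow> real) \<Rightarrow> (nat \<Rightarrow> 'a \<Rightarrow> ennreal) \<Rightarrow> ('a \<Rightarrow> ennreal) \<Rightarrow> bool" where
  "uniformly_bounded_avg_ops X d M m \<eta> p q ws w \<longleftrightarrow>
     (\<exists>C::real. \<forall>B\<in>qballs X d. avg_op_bound M m \<eta> p q ws w B (ennreal C))"

end

theory Submission
  imports Defs
begin

text \<open>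
  On a ball \<open>B\<close> the operator produces a constant multiple \<open>c \<chi>\<^sub>B\<close> of the indicator of \<open>B\<close>, with
  \<open>c = \<mu>(B)\<^bsup>\<eta> - m\<^esup> \<Prod>\<^sub>i \<integral>\<^sub>B \<bar>f\<^sub>i\<bar>\<close>, and the weak norm of such a function is exactly
  \<open>c \<parallel>\<omega> \<chi>\<^sub>B\<parallel>\<^sub>q\<close>. Both inequalities are therefore statements about how large \<open>\<integral>\<^sub>B \<bar>f\<^sub>i\<bar>\<close> can be when
  \<open>\<parallel>\<omega>\<^sub>i f\<^sub>i\<parallel>\<^sub>p\<^sub>i\<close> is given, that is, about the duality of \<open>p\<^sub>i\<close> and \<open>p\<^sub>i'\<close>, one function at a time.

  The operator norms are bounded by the weight constant because Hoelder's inequality bounds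
  \<open>\<integral>\<^sub>B \<bar>f\<^sub>i\<bar> = \<integral> (\<omega>\<^sub>i \<bar>f\<^sub>i\<bar>) (\<omega>\<^sub>i\<^sup>-\<^sup>1 \<chi>\<^sub>B)\<close> by \<open>K\<^sub>i \<parallel>\<omega>\<^sub>i f\<^sub>i\<parallel>\<^sub>p\<^sub>i \<parallel>\<omega>\<^sub>i\<^sup>-\<^sup>1 \<chi>\<^sub>B\<parallel>\<^sub>p\<^sub>i'\<close> (lemma
  \<open>vnorm_holder\<close>).

  The weight constant is bounded by the operator norms, with constant \<open>C = 1\<close>, because Hoelder's
  inequality is nearly attained (lemma \<open>vnorm_conj_exp_near_attained\<close>): for every
  \<open>a < \<parallel>g\<parallel>\<^sub>p'\<close> there is a function \<open>f\<close> in the unit ball of \<open>L\<^sup>p\<close> with \<open>\<integral> f g \<ge> a\<close>. Taking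
  \<open>g = \<omega>\<^sub>i\<^sup>-\<^sup>1 \<chi>\<^sub>B\<close> and testing the operator on \<open>f\<^sub>i = f \<omega>\<^sub>i\<^sup>-\<^sup>1 \<chi>\<^sub>B\<close> gives the claim as the \<open>a\<close>'s
  increase to the norms. Phrasing this with numbers \<open>a\<close> below the norm, and not with extremal
  functions, covers the case of an infinite norm, so that bounded operators are seen to force the
  weight constant to be finite.\<close>

section \<open>Luxemburg norms of extended nonnegative functions\<close>

lemma epow_ennreal: "0 \<le> r \<Longrightarrow> epow (ennreal r) s = ennreal (r powr s)"
  by (simp add: epow_def)

lemma epow_top: "epow top s = top"
  by (simp add: epow_def)

lemma borel_measurable_epow [measurable (raw)]:
  fixes f :: "'a \<Rightarrow> ennreal" and p :: "'a \<Rightarrow> real"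
  assumes [measurable]: "f \<in> borel_measurable M" "p \<in> borel_measurable M"
  shows "(\<lambda>x. epow (f x) (p x)) \<in> borel_measurable M"
  unfolding epow_def by measurable

lemma vnorm_le:
  "0 < l \<Longrightarrow> (\<integral>\<^sup>+x. epow (f x / ennreal l) (p x) \<partial>M) \<le> 1 \<Longrightarrow> vnorm M p f \<le> ennreal l"
  unfolding vnorm_def by (rule Inf_lower) auto

lemma vnorm_greatest:
  assumes "\<And>l. 0 < l \<Longrightarrow> (\<integral>\<^sup>+x. epow (f x / ennreal l) (p x) \<partial>M) \<le> 1 \<Longrightarrow> c \<le> ennreal l"
  shows "c \<le> vnorm M p f"
  unfolding vnorm_def using assms by (intro Inf_greatest) auto

lemma vnorm_zero: "vnorm M p (\<lambda>x. 0) = 0"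
proof -
  have "vnorm M p (\<lambda>x. 0) \<le> 0 + ennreal e" if "e > 0" for e
    using that by (simp, intro vnorm_le) (auto simp: epow_def)
  then have "vnorm M p (\<lambda>x. 0) \<le> 0"
    by (rule ennreal_le_epsilon)
  then show ?thesis by simp
qed

lemma epow_mono:
  assumes "u \<le> v" "0 \<le> s"
  shows "epow u s \<le> epow v s"
  using assms by (cases u; cases v) (auto simp: epow_ennreal epow_top top_unique intro!: ennreal_leI powr_mono2)

lemma vnorm_mono_AE:
  assumes "AE x in M. f x \<le> g x" "AE x in M. 0 \<le> p x"
  shows "vnorm M p f \<le> vnorm M p g"
proof (rule vnorm_greatest)
  fix l :: real
  assume l: "0 < l" and g: "(\<integral>\<^sup>+x. epow (g x / ennreal l) (p x) \<partial>M) \<le> 1"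
  have "(\<integral>\<^sup>+x. epow (f x / ennreal l) (p x) \<partial>M) \<le> (\<integral>\<^sup>+x. epow (g x / ennreal l) (p x) \<partial>M)"
    using assms
    by (intro nn_integral_mono_AE, eventually_elim) (intro epow_mono divide_right_mono_ennreal)
  with l g show "vnorm M p f \<le> ennreal l"
    by (intro vnorm_le order_trans[OF _ g])
qed

lemma vnorm_cmult:
  assumes "0 < t"
  shows "vnorm M p (\<lambda>x. ennreal t * f x) = ennreal t * vnorm M p f"
proof -
  have *: "ennreal s * vnorm M p g \<le> vnorm M p (\<lambda>x. ennreal s * g x)" if s: "0 < s" for s g
  proof (rule vnorm_greatest)
    fix l :: real
    assume l: "0 < l" and le: "(\<integral>\<^sup>+x. epow (ennreal s * g x / ennreal l) (p x) \<partial>M) \<le> 1"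
    have "ennreal s * g x / ennreal l = g x / ennreal (l / s)" for x
      using s l
      by (cases "g x") (auto simp: divide_ennreal ennreal_mult[symmetric] ennreal_mult_top
            ennreal_top_divide)
    then have "vnorm M p g \<le> ennreal (l / s)"
      using le s l by (intro vnorm_le) auto
    then have "ennreal s * vnorm M p g \<le> ennreal s * ennreal (l / s)"
      by (rule mult_left_mono) simp
    also have "\<dots> = ennreal l"
      using s l by (simp add: ennreal_mult[symmetric])
    finally show "ennreal s * vnorm M p g \<le> ennreal l" .
  qed
  have inv: "ennreal t * (ennreal (1 / t) * y) = y" for y
    using assms by (simp add: mult.assoc[symmetric] ennreal_mult[symmetric])
  have inv': "ennreal (1 / t) * (ennreal t * y) = y" for y
    using assms by (simp add: mult.assoc[symmetric] ennreal_mult[symmetric])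
  have "ennreal (1 / t) * vnorm M p (\<lambda>x. ennreal t * f x) \<le> vnorm M p f"
    using *[of "1 / t" "\<lambda>x. ennreal t * f x"] assms by (simp add: inv')
  then have "ennreal t * (ennreal (1 / t) * vnorm M p (\<lambda>x. ennreal t * f x)) \<le> ennreal t * vnorm M p f"
    by (rule mult_left_mono) simp
  with *[OF assms, of f] show ?thesis
    by (simp add: inv antisym)
qed

text \<open>Functions of norm \<open>0\<close> have to be recognized because the convention \<open>0 * \<infinity> = 0\<close> turns Hoelder's
  inequality into a statement about them. For exponents at least \<open>1\<close>, the modular controls the
  excess of \<open>f\<close> over any level: \<open>f - l \<le> l (f / l)\<^sup>p\<close>. When the norm is \<open>0\<close>, the integral of the
  excess over a fixed level is thus at most \<open>l\<close> for arbitrarily small \<open>l\<close>.\<close>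

lemma vnorm_eq_0_imp_AE:
  assumes [measurable]: "f \<in> borel_measurable M" "p \<in> borel_measurable M"
    and p: "AE x in M. 1 \<le> p x" and zero: "vnorm M p f = 0"
  shows "AE x in M. f x = 0"
proof -
  have excess: "u - ennreal e \<le> ennreal l * epow (u / ennreal l) s"
    if "0 < l" "l \<le> e" "1 \<le> s" for u :: ennreal and l e s :: real
  proof (cases u)
    case (real r)
    show ?thesis
    proof (cases "r \<le> e")
      case True
      then show ?thesis
        using real that by (simp add: ennreal_minus ennreal_neg)
    next
      case False
      then have r: "1 \<le> r / l" using that by simp
      have "r - e \<le> l * (r / l) powr 1" using that r by auto
      also have "\<dots> \<le> l * (r / l) powr s"
        using that r by (intro mult_left_mono powr_mono) auto
      finally show ?thesis
        using real that
        by (simp add: ennreal_minus divide_ennreal epow_ennreal ennreal_mult[symmetric] ennreal_leI)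
    qed
  qed (use that in \<open>simp add: ennreal_top_divide epow_top ennreal_mult_top\<close>)
  have small: "AE x in M. f x \<le> ennreal e" if e: "e > 0" for e
  proof -
    have "(\<integral>\<^sup>+x. (f x - ennreal e) \<partial>M) \<le> 0 + ennreal \<epsilon>" if eps: "\<epsilon> > 0" for \<epsilon>
    proof -
      have "vnorm M p f < ennreal (min e \<epsilon>)" using zero e eps by (simp add: ennreal_less_zero_iff)
      then obtain l where l: "0 < l" "ennreal l < ennreal (min e \<epsilon>)"
          "(\<integral>\<^sup>+x. epow (f x / ennreal l) (p x) \<partial>M) \<le> 1"
        unfolding vnorm_def Inf_less_iff by auto
      then have l': "l < e" "l < \<epsilon>" by (auto simp: ennreal_less_iff)
      have "(\<integral>\<^sup>+x. (f x - ennreal e) \<partial>M) \<le> (\<integral>\<^sup>+x. ennreal l * epow (f x / ennreal l) (p x) \<partial>M)"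
        using p l l' by (intro nn_integral_mono_AE) (auto intro!: excess)
      also have "\<dots> = ennreal l * (\<integral>\<^sup>+x. epow (f x / ennreal l) (p x) \<partial>M)"
        by (rule nn_integral_cmult) measurable
      also have "\<dots> \<le> ennreal l * 1"
        using l by (intro mult_left_mono) auto
      finally show ?thesis using l' by (simp add: order_trans[OF _ ennreal_leI])
    qed
    then have "(\<integral>\<^sup>+x. (f x - ennreal e) \<partial>M) \<le> 0"
      by (rule ennreal_le_epsilon)
    then have "AE x in M. f x - ennreal e = 0"
      by (subst (asm) le_zero_eq, subst (asm) nn_integral_0_iff_AE) auto
    then show ?thesis
      by eventually_elim (simp add: diff_eq_0_iff_ennreal)
  qed
  have "AE x in M. \<forall>n. f x \<le> ennreal (1 / real (Suc n))"
    by (subst AE_all_countable) (auto intro!: small simp del: of_nat_Suc)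
  then show ?thesis
  proof eventually_elim
    case (elim x)
    have "f x \<le> 0 + ennreal e" if e: "e > 0" for e
    proof -
      obtain n where "1 / real (Suc n) < e"
        using nat_approx_posE[OF e] .
      then show ?thesis
        using elim[rule_format, of n] by (simp add: order_trans[OF _ ennreal_leI])
    qed
    then have "f x \<le> 0" by (rule ennreal_le_epsilon)
    then show ?case by simp
  qed
qed

section \<open>Duality of conjugate variable exponents\<close>

lemma exponents_bounds:
  assumes "p \<in> exponents M"
  obtains a b where "exp_minus M p = ereal a" "exp_plus M p = ereal b" "1 < a" "a \<le> b"
    "AE x in M. a \<le> p x \<and> p x \<le> b"
proof -
  have h: "1 < exp_minus M p" "exp_minus M p \<le> exp_plus M p" "exp_plus M p < \<infinity>"
    using assms by (auto simp: exponents_def)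
  then obtain a where a: "exp_minus M p = ereal a" by (cases "exp_minus M p") auto
  from h obtain b where b: "exp_plus M p = ereal b" by (cases "exp_plus M p") auto
  have "esssup M (\<lambda>x. - ereal (p x)) = ereal (- a)"
    using a unfolding exp_minus_def by (cases "esssup M (\<lambda>x. - ereal (p x))") auto
  then have "AE x in M. - ereal (p x) \<le> ereal (- a)"
    using esssup_AE[where M=M and f="\<lambda>x. - ereal (p x)"] by simp
  moreover have "AE x in M. ereal (p x) \<le> ereal b"
    using esssup_AE[where M=M and f="\<lambda>x. ereal (p x)"] b by (simp add: exp_plus_def)
  ultimately have "AE x in M. a \<le> p x \<and> p x \<le> b"
    by eventually_elim auto
  with a b h show thesis by (intro that[of a b]) auto
qed

lemma AE_exponents_gt_1: "p \<in> exponents M \<Longrightarrow> AE x in M. 1 < p x"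
  by (erule exponents_bounds) (auto elim!: eventually_mono)

lemma borel_measurable_conj_exp:
  assumes [measurable]: "p \<in> borel_measurable M"
  shows "conj_exp p \<in> borel_measurable M"
  unfolding conj_exp_def[abs_def] by measurable

lemma Young_epow:
  assumes "1 < s"
  shows "u * v \<le> ennreal (1 / s) * epow u s + ennreal (1 - 1 / s) * epow v (s / (s - 1))"
proof -
  have c: "0 < 1 / s" "0 < 1 - 1 / s" using assms by auto
  show ?thesis
  proof (cases u)
    case (real a)
    show ?thesis
    proof (cases v)
      case (real b)
      have "a * b \<le> a powr s / s + b powr (s / (s - 1)) / (s / (s - 1))"
        using assms \<open>0 \<le> a\<close> \<open>0 \<le> b\<close> by (intro Youngs_inequality) (auto simp: field_simps)
      also have "\<dots> = 1 / s * a powr s + (1 - 1 / s) * b powr (s / (s - 1))"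
        using assms by (simp add: field_simps)
      finally show ?thesis
        using \<open>u = ennreal a\<close> real \<open>0 \<le> a\<close> c
        by (simp add: epow_ennreal ennreal_mult[symmetric] ennreal_plus[symmetric] ennreal_leI
              del: ennreal_plus)
    qed (use c in \<open>simp add: epow_top ennreal_mult_top\<close>)
  qed (use c in \<open>simp add: epow_top ennreal_mult_top\<close>)
qed

lemma mult_divide_cancel_ennreal: "0 < c \<Longrightarrow> c < top \<Longrightarrow> c * (y / c) = (y :: ennreal)"
  using mult_divide_eq_ennreal[of c y] by (simp add: ennreal_times_divide mult.commute)

lemma le_mult_of_divide_le_ennreal:
  assumes "0 < c" "c < top" "y / c \<le> (z :: ennreal)"
  shows "y \<le> c * z"
  using mult_left_mono[OF assms(3), of c] assms(1,2) by (simp add: mult_divide_cancel_ennreal)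

text \<open>Young's inequality gives \<open>\<integral> (f / l) (g / k) \<le> \<integral> (f / l)\<^sup>p / p + \<integral> (g / k)\<^sup>p' / p'\<close> for all
  admissible scalings \<open>l\<close> and \<open>k\<close>. As \<open>p\<close> depends on the point, the two weights \<open>1 / p \<le> 1 / p\<^sub>-\<close>
  and \<open>1 / p' \<le> 1 - 1 / p\<^sub>+\<close> have to be estimated separately; the sum of their bounds is the constant.\<close>

lemma vnorm_holder:
  assumes p: "p \<in> exponents M"
    and f [measurable]: "f \<in> borel_measurable M" and g [measurable]: "g \<in> borel_measurable M"
  shows "(\<integral>\<^sup>+x. f x * g x \<partial>M) \<le> ennreal (holder_const M p) * (vnorm M p f * vnorm M (conj_exp p) g)"
proof -
  have pm [measurable]: "p \<in> borel_measurable M" using p by (simp add: exponents_def)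
  have cm [measurable]: "conj_exp p \<in> borel_measurable M" by (rule borel_measurable_conj_exp[OF pm])
  obtain a b where ab: "exp_minus M p = ereal a" "exp_plus M p = ereal b" "1 < a" "a \<le> b"
    "AE x in M. a \<le> p x \<and> p x \<le> b"
    using exponents_bounds[OF p] .
  define K where "K = holder_const M p"
  have K: "K = 1 / a + (1 - 1 / b)" using ab by (simp add: K_def holder_const_def)
  have c: "0 < 1 / a" "0 < 1 - 1 / b" "0 < K" using ab by (auto simp: K add_pos_pos)
  have scaled: "(\<integral>\<^sup>+x. f x * g x \<partial>M) \<le> ennreal K * (ennreal l * ennreal k)"
    if l: "0 < l" "(\<integral>\<^sup>+x. epow (f x / ennreal l) (p x) \<partial>M) \<le> 1"
      and k: "0 < k" "(\<integral>\<^sup>+x. epow (g x / ennreal k) (conj_exp p x) \<partial>M) \<le> 1" for l k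
  proof -
    let ?u = "\<lambda>x. f x / ennreal l" and ?v = "\<lambda>x. g x / ennreal k"
    have fg: "f x * g x = ennreal (l * k) * (?u x * ?v x)" for x
    proof -
      have "ennreal (l * k) * (?u x * ?v x) = (ennreal l * ?u x) * (ennreal k * ?v x)"
        using l k by (simp add: ennreal_mult ac_simps)
      then show ?thesis
        using l k by (simp add: mult_divide_cancel_ennreal)
    qed
    have "(\<integral>\<^sup>+x. ?u x * ?v x \<partial>M) \<le>
        (\<integral>\<^sup>+x. ennreal (1 / a) * epow (?u x) (p x) + ennreal (1 - 1 / b) * epow (?v x) (conj_exp p x) \<partial>M)"
      using ab(5)
    proof (intro nn_integral_mono_AE, eventually_elim)
      case (elim x)
      have "?u x * ?v x \<le> ennreal (1 / p x) * epow (?u x) (p x)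
          + ennreal (1 - 1 / p x) * epow (?v x) (conj_exp p x)"
        unfolding conj_exp_def using elim ab by (intro Young_epow) auto
      also have "\<dots> \<le> ennreal (1 / a) * epow (?u x) (p x) + ennreal (1 - 1 / b) * epow (?v x) (conj_exp p x)"
        using elim ab by (intro add_mono mult_right_mono ennreal_leI) (auto intro!: frac_le)
      finally show ?case .
    qed
    also have "\<dots> = ennreal (1 / a) * (\<integral>\<^sup>+x. epow (?u x) (p x) \<partial>M)
        + ennreal (1 - 1 / b) * (\<integral>\<^sup>+x. epow (?v x) (conj_exp p x) \<partial>M)"
      by (subst nn_integral_add) (auto simp: nn_integral_cmult)
    also have "\<dots> \<le> ennreal (1 / a) * 1 + ennreal (1 - 1 / b) * 1"
      using l k by (intro add_mono mult_left_mono) auto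
    also have "\<dots> = ennreal K"
      using c by (simp add: K ennreal_plus[symmetric] del: ennreal_plus)
    finally have "ennreal (l * k) * (\<integral>\<^sup>+x. ?u x * ?v x \<partial>M) \<le> ennreal (l * k) * ennreal K"
      by (rule mult_left_mono) simp
    moreover have "(\<integral>\<^sup>+x. f x * g x \<partial>M) = ennreal (l * k) * (\<integral>\<^sup>+x. ?u x * ?v x \<partial>M)"
      unfolding fg by (rule nn_integral_cmult) measurable
    ultimately show ?thesis
      using l k by (simp add: ennreal_mult ac_simps)
  qed
  show ?thesis
  proof (cases "vnorm M p f = 0 \<or> vnorm M (conj_exp p) g = 0")
    case True
    have p1: "AE x in M. 1 \<le> p x" "AE x in M. 1 \<le> conj_exp p x"
      using AE_exponents_gt_1[OF p] by (auto elim!: eventually_mono simp: conj_exp_def)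
    from True have "AE x in M. f x * g x = 0"
      using vnorm_eq_0_imp_AE[OF f pm p1(1)] vnorm_eq_0_imp_AE[OF g cm p1(2)]
      by (auto elim!: eventually_mono)
    then have "(\<integral>\<^sup>+x. f x * g x \<partial>M) = 0"
      by (subst nn_integral_0_iff_AE) auto
    then show ?thesis by simp
  next
    case False
    \<comment> \<open>Infima may now be taken over \<open>l\<close> and then over \<open>k\<close>, by dividing by the other factor.\<close>
    have step: "(\<integral>\<^sup>+x. f x * g x \<partial>M) \<le> ennreal K * (vnorm M p f * ennreal k)"
      if k: "0 < k" "(\<integral>\<^sup>+x. epow (g x / ennreal k) (conj_exp p x) \<partial>M) \<le> 1" for k
    proof -
      have pos: "0 < ennreal K * ennreal k" "ennreal K * ennreal k < top"
        using c k by (auto simp: ennreal_mult[symmetric])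
      have "(\<integral>\<^sup>+x. f x * g x \<partial>M) / (ennreal K * ennreal k) \<le> vnorm M p f"
        using pos scaled[OF _ _ k]
        by (intro vnorm_greatest divide_le_posI_ennreal) (auto simp: ac_simps)
      from le_mult_of_divide_le_ennreal[OF pos this] show ?thesis
        by (simp only: ac_simps)
    qed
    show ?thesis
    proof (cases "vnorm M p f = top")
      case True
      then show ?thesis
        using False c by (simp add: ennreal_mult_top ennreal_top_mult K_def)
    next
      case fin: False
      have pos: "0 < ennreal K * vnorm M p f" "ennreal K * vnorm M p f < top"
        using c False fin by (auto simp: ennreal_zero_less_mult_iff ennreal_mult_less_top less_top zero_less_iff_neq_zero)
      have "(\<integral>\<^sup>+x. f x * g x \<partial>M) / (ennreal K * vnorm M p f) \<le> vnorm M (conj_exp p) g"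
        using pos step
        by (intro vnorm_greatest divide_le_posI_ennreal) (auto simp: ac_simps)
      from le_mult_of_divide_le_ennreal[OF pos this] show ?thesis
        by (simp only: ac_simps K_def)
    qed
  qed
qed

text \<open>With \<open>h = (g / a)\<^sup>p'\<close>, the extremal function for Hoelder's inequality is a multiple of
  \<open>h\<^bsup>1/p\<^esup>\<close>, and \<open>a < \<parallel>g\<parallel>\<^sub>p'\<close> says that \<open>\<integral> h > 1\<close>. Truncating \<open>h\<close> at a high level to \<open>s\<close> keeps the
  integral above \<open>1\<close> and makes it finite, as \<open>g\<close> lives on a set of finite measure. Normalizing by
  \<open>J = \<integral> s\<close> itself and not by the usual \<open>J\<^bsup>1/p\<^esup>\<close> suffices: \<open>J\<^sup>p \<ge> J\<close> as \<open>J > 1\<close>, whence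
  \<open>\<integral> (s\<^bsup>1/p\<^esup> / J)\<^sup>p \<le> 1\<close>, and \<open>\<integral> (s\<^bsup>1/p\<^esup> / J) g \<ge> (a / J) \<integral> s = a\<close> because
  \<open>g = a h\<^bsup>1/p'\<^esup> \<ge> a s\<^bsup>1/p'\<^esup>\<close>.\<close>

lemma vnorm_conj_exp_near_attained:
  fixes g :: "'a \<Rightarrow> ennreal"
  assumes p: "p \<in> exponents M" and g [measurable]: "g \<in> borel_measurable M"
    and S [measurable]: "S \<in> sets M" and fin: "emeasure M S < \<infinity>"
    and supp: "\<And>x. x \<in> space M - S \<Longrightarrow> g x = 0" and gfin: "AE x in M. g x < \<infinity>"
    and a: "0 < a" "ennreal a < vnorm M (conj_exp p) g"
  obtains f :: "'a \<Rightarrow> real" where "f \<in> borel_measurable M" "\<And>x. 0 \<le> f x"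
    "vnorm M p (\<lambda>x. ennreal (f x)) \<le> 1" "ennreal a \<le> (\<integral>\<^sup>+x. ennreal (f x) * g x \<partial>M)"
proof -
  have pm [measurable]: "p \<in> borel_measurable M" using p by (simp add: exponents_def)
  have cm [measurable]: "conj_exp p \<in> borel_measurable M" by (rule borel_measurable_conj_exp[OF pm])
  note p1 = AE_exponents_gt_1[OF p]
  define \<gamma> where "\<gamma> x = enn2real (g x) / a" for x
  define h where "h x = \<gamma> x powr conj_exp p x" for x
  have [measurable]: "\<gamma> \<in> borel_measurable M" unfolding \<gamma>_def[abs_def] by measurable
  have [measurable]: "h \<in> borel_measurable M" unfolding h_def[abs_def] by measurable
  have \<gamma>0: "0 \<le> \<gamma> x" for x using a by (simp add: \<gamma>_def)
  have h0: "0 \<le> h x" for x by (simp add: h_def)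
  have g_eq: "AE x in M. g x = ennreal (a * \<gamma> x)"
    using gfin by eventually_elim (use a in \<open>simp add: \<gamma>_def\<close>)
  have "1 < (\<integral>\<^sup>+x. epow (g x / ennreal a) (conj_exp p x) \<partial>M)"
    using vnorm_le[OF a(1)] a(2) leD not_le_imp_less by blast
  also have "\<dots> = (\<integral>\<^sup>+x. ennreal (h x) \<partial>M)"
    using g_eq
  proof (intro nn_integral_cong_AE, eventually_elim)
    case (elim x)
    show ?case
      unfolding elim using a \<gamma>0[of x] by (simp add: divide_ennreal epow_ennreal h_def)
  qed
  also have "\<dots> = (\<integral>\<^sup>+x. (SUP k. ennreal (min (h x) (real k))) \<partial>M)"
  proof (intro nn_integral_cong antisym)
    fix x
    obtain k where "h x \<le> real k" using real_arch_simple by blast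
    then show "ennreal (h x) \<le> (SUP k. ennreal (min (h x) (real k)))"
      by (intro SUP_upper2[of k]) auto
    show "(SUP k. ennreal (min (h x) (real k))) \<le> ennreal (h x)"
      by (intro SUP_least ennreal_leI) auto
  qed
  also have "\<dots> = (SUP k. (\<integral>\<^sup>+x. ennreal (min (h x) (real k)) \<partial>M))"
    by (intro nn_integral_monotone_convergence_SUP)
      (auto simp: incseq_def le_fun_def intro!: ennreal_leI)
  finally obtain k :: nat where k: "1 < (\<integral>\<^sup>+x. ennreal (min (h x) (real k)) \<partial>M)"
    unfolding less_SUP_iff by auto
  define s where "s x = min (h x) (real k)" for x
  have [measurable]: "s \<in> borel_measurable M" unfolding s_def[abs_def] by measurable
  have s0: "0 \<le> s x" and sh: "s x \<le> h x" for x using h0 by (auto simp: s_def)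
  have "(\<integral>\<^sup>+x. ennreal (s x) \<partial>M) \<le> (\<integral>\<^sup>+x. ennreal (real k) * indicator S x \<partial>M)"
  proof (intro nn_integral_mono)
    fix x assume "x \<in> space M"
    then show "ennreal (s x) \<le> ennreal (real k) * indicator S x"
      using supp[of x] a by (cases "x \<in> S") (auto simp: s_def h_def \<gamma>_def intro!: ennreal_leI)
  qed
  also have "\<dots> = ennreal (real k) * emeasure M S"
    by (rule nn_integral_cmult_indicator) simp
  also have "\<dots> < top"
    using fin by (simp add: ennreal_mult_less_top)
  finally obtain J where J: "(\<integral>\<^sup>+x. ennreal (s x) \<partial>M) = ennreal J" "1 < J"
    using k by (cases "\<integral>\<^sup>+x. ennreal (s x) \<partial>M") (auto simp: s_def simp flip: ennreal_1 simp: ennreal_less_iff)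
  define f where "f x = s x powr (1 / p x) / J" for x
  have [measurable]: "f \<in> borel_measurable M" unfolding f_def[abs_def] by measurable
  have f0: "0 \<le> f x" for x using J by (simp add: f_def)
  show thesis
  proof (rule that[of f])
    have "(\<integral>\<^sup>+x. epow (ennreal (f x) / ennreal 1) (p x) \<partial>M) \<le> (\<integral>\<^sup>+x. ennreal (1 / J) * ennreal (s x) \<partial>M)"
      using p1
    proof (intro nn_integral_mono_AE, eventually_elim)
      case (elim x)
      have "f x powr p x = s x / J powr p x"
        using elim J s0[of x] by (simp add: f_def powr_divide powr_powr)
      also have "\<dots> \<le> s x / J powr 1"
        using elim J s0[of x] by (intro divide_left_mono powr_mono) auto
      finally show ?case
        using J s0[of x] f0[of x] by (simp add: divide_ennreal_def epow_ennreal ennreal_mult[symmetric] ennreal_leI)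
    qed
    also have "\<dots> = ennreal (1 / J) * ennreal J"
      unfolding J(1)[symmetric] by (rule nn_integral_cmult) measurable
    also have "\<dots> = 1"
      using J(2) by (simp add: ennreal_mult[symmetric])
    finally show "vnorm M p (\<lambda>x. ennreal (f x)) \<le> 1"
      using vnorm_le[OF zero_less_one] by fastforce
    have "ennreal a = ennreal (a / J) * ennreal J"
      using J a by (simp add: ennreal_mult[symmetric])
    also have "\<dots> = (\<integral>\<^sup>+x. ennreal (a / J) * ennreal (s x) \<partial>M)"
      unfolding J(1)[symmetric] by (rule nn_integral_cmult[symmetric]) measurable
    also have "\<dots> \<le> (\<integral>\<^sup>+x. ennreal (f x) * g x \<partial>M)"
      using p1 g_eq
    proof (intro nn_integral_mono_AE, eventually_elim)
      case (elim x)
      have "s x \<le> s x powr (1 / p x) * \<gamma> x"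
      proof (cases "s x = 0")
        case True
        then show ?thesis using \<gamma>0 by simp
      next
        case False
        then have pos: "0 < s x" "0 < h x" using s0[of x] sh[of x] by auto
        then have "0 < \<gamma> x" using \<gamma>0[of x] by (cases "\<gamma> x = 0") (auto simp: h_def)
        have "s x powr (1 - 1 / p x) \<le> h x powr (1 - 1 / p x)"
          using sh[of x] pos elim by (intro powr_mono2) auto
        also have "\<dots> = \<gamma> x powr (p x / (p x - 1) * (1 - 1 / p x))"
          by (simp add: h_def powr_powr conj_exp_def)
        also have "p x / (p x - 1) * (1 - 1 / p x) = 1"
          using elim by (simp add: field_simps)
        finally have "s x powr (1 - 1 / p x) \<le> \<gamma> x" using \<open>0 < \<gamma> x\<close> by simp
        then have "s x powr (1 / p x) * s x powr (1 - 1 / p x) \<le> s x powr (1 / p x) * \<gamma> x"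
          by (rule mult_left_mono) simp
        then show ?thesis using pos by (simp add: powr_add[symmetric])
      qed
      then have "a / J * s x \<le> a / J * (s x powr (1 / p x) * \<gamma> x)"
        using a J by (intro mult_left_mono) auto
      also have "\<dots> = f x * (a * \<gamma> x)"
        by (simp add: f_def)
      finally have "a / J * s x \<le> f x * (a * \<gamma> x)" .
      moreover have "g x = ennreal (a * \<gamma> x)" using elim by blast
      ultimately show ?case
        using a J s0[of x] f0[of x] \<gamma>0[of x]
        by (simp add: ennreal_mult[symmetric] ennreal_leI)
    qed
    finally show "ennreal a \<le> (\<integral>\<^sup>+x. ennreal (f x) * g x \<partial>M)" .
  qed (use f0 in auto)
qed

section \<open>Averages over one ball\<close>

text \<open>The value \<open>0\<close> is admitted so that the index set is nonempty when \<open>n = 0\<close>.\<close>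

lemma ennreal_eq_SUP_below:
  fixes n :: ennreal
  shows "n = (SUP b\<in>{b. 0 \<le> b \<and> (b = 0 \<or> ennreal b < n)}. ennreal b)"
proof (rule antisym)
  show "n \<le> (SUP b\<in>{b. 0 \<le> b \<and> (b = 0 \<or> ennreal b < n)}. ennreal b)"
  proof (rule dense_le)
    fix y assume y: "y < n"
    then obtain r where "y = ennreal r" "0 \<le> r" by (cases y) auto
    then show "y \<le> (SUP b\<in>{b. 0 \<le> b \<and> (b = 0 \<or> ennreal b < n)}. ennreal b)"
      using y by (intro SUP_upper2[of r]) auto
  qed
qed (auto intro!: SUP_least)

text \<open>The test functions only give numbers below each of the norms, some of which may be infinite. The
  factors are pushed up to their suprema one at a time, the approximations of the other factors
  being absorbed into \<open>K\<close>; this is why \<open>K\<close> varies in the induction.\<close>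

lemma mult_prod_le_of_approx:
  fixes n :: "'i \<Rightarrow> ennreal"
  assumes "finite I"
    and "\<And>a :: 'i \<Rightarrow> real. (\<forall>i\<in>I. 0 \<le> a i \<and> (a i = 0 \<or> ennreal (a i) < n i)) \<Longrightarrow>
      K * (\<Prod>i\<in>I. ennreal (a i)) \<le> N"
  shows "K * (\<Prod>i\<in>I. n i) \<le> N"
  using assms
proof (induction I arbitrary: K)
  case empty
  then show ?case by simp
next
  case (insert j I)
  have "K * (\<Prod>i\<in>insert j I. n i) = n j * (K * (\<Prod>i\<in>I. n i))"
    using insert by (simp add: ac_simps)
  also have "\<dots> = (SUP b\<in>{b. 0 \<le> b \<and> (b = 0 \<or> ennreal b < n j)}. ennreal b * (K * (\<Prod>i\<in>I. n i)))"
    by (subst ennreal_eq_SUP_below[of "n j"]) (rule SUP_mult_right_ennreal)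
  also have "\<dots> \<le> N"
  proof (rule SUP_least)
    fix b assume b: "b \<in> {b. 0 \<le> b \<and> (b = 0 \<or> ennreal b < n j)}"
    have "(K * ennreal b) * (\<Prod>i\<in>I. n i) \<le> N"
    proof (rule insert.IH)
      fix a :: "'i \<Rightarrow> real" assume a: "\<forall>i\<in>I. 0 \<le> a i \<and> (a i = 0 \<or> ennreal (a i) < n i)"
      have "(\<Prod>i\<in>I. ennreal ((a(j := b)) i)) = (\<Prod>i\<in>I. ennreal (a i))"
        using insert.hyps by (intro prod.cong) auto
      moreover have "K * (\<Prod>i\<in>insert j I. ennreal ((a(j := b)) i)) \<le> N"
        using a b by (intro insert.prems) auto
      ultimately show "(K * ennreal b) * (\<Prod>i\<in>I. ennreal (a i)) \<le> N"
        using insert.hyps by (simp add: ac_simps)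
    qed
    then show "ennreal b * (K * (\<Prod>i\<in>I. n i)) \<le> N" by (simp add: ac_simps)
  qed
  finally show ?case .
qed

text \<open>The level set of \<open>c \<chi>\<^sub>B\<close> at height \<open>t > 0\<close> is \<open>B\<close> for \<open>t < c\<close> and empty otherwise.\<close>

lemma weak_norm_cmult_indicator:
  assumes B: "B \<subseteq> space M"
  shows "weak_norm M q w (\<lambda>x. c * indicator B x) = c * vnorm M q (\<lambda>x. w x * indicator B x)"
    (is "?W = c * ?N")
proof -
  have level: "vnorm M q (\<lambda>x. ennreal t * w x * indicator {y \<in> space M. c * indicator B y > ennreal t} x)
      = (if ennreal t < c then ennreal t * ?N else 0)" if t: "t > 0" for t
  proof -
    have "{y \<in> space M. c * indicator B y > ennreal t} = (if ennreal t < c then B else {})"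
      using B by (auto simp: indicator_def)
    then show ?thesis
      using vnorm_cmult[OF t, of M q "\<lambda>x. w x * indicator B x"]
      by (simp add: vnorm_zero mult.assoc)
  qed
  show ?thesis
  proof (rule antisym)
    show "?W \<le> c * ?N"
      unfolding weak_norm_def
    proof (rule SUP_least)
      fix t :: real assume "t \<in> {0<..}"
      then show "vnorm M q (\<lambda>x. ennreal t * w x * indicator {y \<in> space M. c * indicator B y > ennreal t} x) \<le> c * ?N"
        by (simp add: level mult_right_mono)
    qed
    have "c * ?N = (SUP b\<in>{b. 0 \<le> b \<and> (b = 0 \<or> ennreal b < c)}. ennreal b * ?N)"
      by (subst ennreal_eq_SUP_below[of c]) (rule SUP_mult_right_ennreal)
    also have "\<dots> \<le> ?W"
    proof (rule SUP_least)
      fix b assume b: "b \<in> {b. 0 \<le> b \<and> (b = 0 \<or> ennreal b < c)}"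
      show "ennreal b * ?N \<le> ?W"
      proof (cases "b = 0")
        case False
        then show ?thesis
          using b level[of b] unfolding weak_norm_def by (intro SUP_upper2[of b]) auto
      qed simp
    qed
    finally show "c * ?N \<le> ?W" .
  qed
qed

lemma weak_norm_avg_op:
  assumes B: "B \<in> sets M" "0 < emeasure M B" "emeasure M B < \<infinity>"
  shows "weak_norm M q w (avg_op M m \<eta> B f) =
    ennreal (measure M B powr (\<eta> - real m)) * vnorm M q (\<lambda>x. w x * indicator B x) *
    (\<Prod>i=1..m. \<integral>\<^sup>+y. ennreal \<bar>f i y\<bar> * indicator B y \<partial>M)"
proof -
  define \<mu> where "\<mu> = measure M B"
  have \<mu>: "emeasure M B = ennreal \<mu>" "0 < \<mu>"
    using B by (auto simp: \<mu>_def measure_def enn2real_positive_iff)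
  let ?I = "\<lambda>i. \<integral>\<^sup>+y. ennreal \<bar>f i y\<bar> * indicator B y \<partial>M"
  have "(\<Prod>i=1..m. ?I i / emeasure M B) = ennreal ((1 / \<mu>) ^ m) * (\<Prod>i=1..m. ?I i)"
    using \<mu> by (simp add: divide_ennreal_def inverse_ennreal prod.distrib ennreal_power
        inverse_eq_divide mult.commute)
  moreover have "\<mu> powr \<eta> * (1 / \<mu>) ^ m = \<mu> powr (\<eta> - real m)"
    using \<mu> by (simp add: powr_diff powr_realpow power_one_over divide_simps)
  then have "ennreal (\<mu> powr \<eta>) * ennreal ((1 / \<mu>) ^ m) = ennreal (\<mu> powr (\<eta> - real m))"
    using \<mu> by (simp add: ennreal_mult[symmetric])
  ultimately have "avg_op M m \<eta> B f =
      (\<lambda>x. (ennreal (\<mu> powr (\<eta> - real m)) * (\<Prod>i=1..m. ?I i)) * indicator B x)"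
    by (simp add: avg_op_def fun_eq_iff \<mu>_def[symmetric] mult.assoc[symmetric])
  then show ?thesis
    unfolding \<mu>_def[symmetric] using sets.sets_into_space[OF B(1)]
    by (simp only: weak_norm_cmult_indicator) (simp only: ac_simps)
qed

lemma mult_inverse_ennreal: "0 < u \<Longrightarrow> u < \<infinity> \<Longrightarrow> u * inverse u = (1 :: ennreal)"
  using ennreal_divide_self[of u] by (simp add: divide_ennreal_def)

text \<open>The factor \<open>w * inverse w\<close> is \<open>1\<close> only where \<open>w\<close> is positive and finite, that is, almost
  everywhere for a weight.\<close>

lemma nn_integral_le_wnorm:
  assumes p: "p \<in> exponents M" and [measurable]: "B \<in> sets M"
    and w [measurable]: "w \<in> borel_measurable M" and w0: "AE x in M. 0 < w x \<and> w x < \<infinity>"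
    and f [measurable]: "f \<in> borel_measurable M"
  shows "(\<integral>\<^sup>+x. ennreal \<bar>f x\<bar> * indicator B x \<partial>M) \<le> ennreal (holder_const M p) *
    (wnorm M p w (\<lambda>x. ennreal \<bar>f x\<bar>) * vnorm M (conj_exp p) (\<lambda>x. inverse (w x) * indicator B x))"
proof -
  have "(\<integral>\<^sup>+x. ennreal \<bar>f x\<bar> * indicator B x \<partial>M) =
      (\<integral>\<^sup>+x. (w x * ennreal \<bar>f x\<bar>) * (inverse (w x) * indicator B x) \<partial>M)"
    using w0
  proof (intro nn_integral_cong_AE, eventually_elim)
    case (elim x)
    have "(w x * ennreal \<bar>f x\<bar>) * (inverse (w x) * indicator B x)
        = (w x * inverse (w x)) * (ennreal \<bar>f x\<bar> * indicator B x)"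
      by (simp only: ac_simps)
    then show ?case
      using elim by (simp add: mult_inverse_ennreal)
  qed
  also have "\<dots> \<le> ennreal (holder_const M p) *
    (wnorm M p w (\<lambda>x. ennreal \<bar>f x\<bar>) * vnorm M (conj_exp p) (\<lambda>x. inverse (w x) * indicator B x))"
    unfolding wnorm_def by (intro vnorm_holder p) measurable
  finally show ?thesis .
qed

text \<open>The nearly extremal function \<open>u\<close> for \<open>w\<^sup>-\<^sup>1 \<chi>\<^sub>B\<close> is turned into the function \<open>u w\<^sup>-\<^sup>1 \<chi>\<^sub>B\<close> of the
  weighted space: multiplying it by \<open>w\<close> leaves at most \<open>u\<close>, and its integral is the pairing of \<open>u\<close>
  with \<open>w\<^sup>-\<^sup>1 \<chi>\<^sub>B\<close>.\<close>

lemma Lspace_near_dual: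
  assumes p: "p \<in> exponents M" and B [measurable]: "B \<in> sets M" and fin: "emeasure M B < \<infinity>"
    and w [measurable]: "w \<in> borel_measurable M" and w0: "AE x in M. 0 < w x \<and> w x < \<infinity>"
    and a: "0 \<le> a" "a = 0 \<or> ennreal a < vnorm M (conj_exp p) (\<lambda>x. inverse (w x) * indicator B x)"
  obtains f where "f \<in> Lspace M p w" "wnorm M p w (\<lambda>x. ennreal \<bar>f x\<bar>) \<le> 1"
    "ennreal a \<le> (\<integral>\<^sup>+x. ennreal \<bar>f x\<bar> * indicator B x \<partial>M)"
proof (cases "a = 0")
  case True
  show thesis
    by (rule that[of "\<lambda>x. 0"]) (auto simp: Lspace_def wnorm_def vnorm_zero True)
next
  case False
  let ?g = "\<lambda>x. inverse (w x) * indicator B x"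
  have gfin: "AE x in M. ?g x < \<infinity>"
    using w0 by eventually_elim (auto simp: indicator_def less_top[symmetric])
  have "0 < a" "ennreal a < vnorm M (conj_exp p) ?g"
    using a False by auto
  then obtain u :: "'a \<Rightarrow> real" where u [measurable]: "u \<in> borel_measurable M" and u0: "\<And>x. 0 \<le> u x"
    and u1: "vnorm M p (\<lambda>x. ennreal (u x)) \<le> 1" and ua: "ennreal a \<le> (\<integral>\<^sup>+x. ennreal (u x) * ?g x \<partial>M)"
    using vnorm_conj_exp_near_attained[OF p _ B fin _ gfin] by auto
  define f where "f x = u x * enn2real (?g x)" for x
  have [measurable]: "f \<in> borel_measurable M" unfolding f_def[abs_def] by measurable
  have f_eq: "AE x in M. ennreal \<bar>f x\<bar> = ennreal (u x) * ?g x"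
    using gfin by eventually_elim (use u0 in \<open>simp add: f_def ennreal_mult abs_mult\<close>)
  have "wnorm M p w (\<lambda>x. ennreal \<bar>f x\<bar>) \<le> vnorm M p (\<lambda>x. ennreal (u x))"
    unfolding wnorm_def
  proof (rule vnorm_mono_AE)
    show "AE x in M. w x * ennreal \<bar>f x\<bar> \<le> ennreal (u x)"
      using f_eq w0
    proof eventually_elim
      case (elim x)
      then have "w x * ennreal \<bar>f x\<bar> = (w x * inverse (w x)) * (ennreal (u x) * indicator B x)"
        by (simp add: ac_simps)
      also have "\<dots> \<le> ennreal (u x)"
        using elim by (simp add: mult_inverse_ennreal indicator_def)
      finally show ?case .
    qed
    show "AE x in M. 0 \<le> p x"
      using AE_exponents_gt_1[OF p] by eventually_elim simp
  qed
  with u1 have f1: "wnorm M p w (\<lambda>x. ennreal \<bar>f x\<bar>) \<le> 1" by simp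
  show thesis
  proof (rule that[of f])
    show "f \<in> Lspace M p w"
      using f1 by (auto simp: Lspace_def intro: le_less_trans)
    show "wnorm M p w (\<lambda>x. ennreal \<bar>f x\<bar>) \<le> 1" by fact
    have "(\<integral>\<^sup>+x. ennreal (u x) * ?g x \<partial>M) = (\<integral>\<^sup>+x. ennreal \<bar>f x\<bar> * indicator B x \<partial>M)"
      using f_eq by (intro nn_integral_cong_AE, eventually_elim) (auto simp: indicator_def)
    with ua show "ennreal a \<le> (\<integral>\<^sup>+x. ennreal \<bar>f x\<bar> * indicator B x \<partial>M)" by simp
  qed
qed

section \<open>The weight constant and the operator norms\<close>

lemma qball_measure:
  assumes X: "homogeneous_type X d M" and B: "B \<in> qballs X d"
  shows "B \<in> sets M" "0 < emeasure M B" "emeasure M B < \<infinity>"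
proof -
  from B obtain x r where x: "x \<in> X" "r > 0" and B_eq: "B = qball X d x r"
    by (auto simp: qballs_def)
  from X obtain C where C: "\<And>x r. x \<in> X \<Longrightarrow> 0 < r \<Longrightarrow>
        0 < emeasure M (qball X d x (2 * r)) \<and>
        emeasure M (qball X d x (2 * r)) \<le> ennreal C * emeasure M (qball X d x r) \<and>
        ennreal C * emeasure M (qball X d x r) < \<infinity>"
    unfolding homogeneous_type_def doubling_measure_def by blast
  show "B \<in> sets M"
    using X B by (auto simp: homogeneous_type_def)
  \<comment> \<open>Doubling bounds from below only the measure of doubled balls, so the radius is halved first.\<close>
  show "0 < emeasure M B"
    using C[of x "r / 2"] x by (simp add: B_eq)
  have "emeasure M (qball X d x r) \<noteq> top"
  proof
    assume "emeasure M (qball X d x r) = top"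
    \<comment> \<open>Then \<open>ennreal C * \<infinity> < \<infinity>\<close> forces \<open>C \<le> 0\<close>, for which the doubled ball would be a null set.\<close>
    with C[OF x] show False
      by (auto simp: ennreal_mult_top split: if_splits)
  qed
  then show "emeasure M B < \<infinity>"
    by (simp add: B_eq less_top)
qed

lemma avg_op_bound_A_const:
  assumes X: "homogeneous_type X d M" and p: "\<forall>i\<in>{1..m}. p i \<in> exponents M"
    and ws: "\<forall>i\<in>{1..m}. weight X d M (ws i)" and B: "B \<in> qballs X d"
  shows "avg_op_bound M m \<eta> p q ws w B
    (ennreal (\<Prod>i=1..m. holder_const M (p i)) * A_const X d M m \<eta> p q ws w)"
  unfolding avg_op_bound_def
proof (intro allI impI)
  fix f assume f: "\<forall>i\<in>{1..m}. f i \<in> Lspace M (p i) (ws i)"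
  note Bm = qball_measure[OF X B]
  let ?F = "\<lambda>i. wnorm M (p i) (ws i) (\<lambda>x. ennreal \<bar>f i x\<bar>)"
  let ?n = "\<lambda>i. vnorm M (conj_exp (p i)) (\<lambda>x. inverse (ws i x) * indicator B x)"
  let ?c = "ennreal (measure M B powr (\<eta> - real m)) * vnorm M q (\<lambda>x. w x * indicator B x)"
  have K0: "0 \<le> holder_const M (p i)" if i: "i \<in> {1..m}" for i
  proof -
    obtain a b where ab: "exp_minus M (p i) = ereal a" "exp_plus M (p i) = ereal b" "1 < a" "a \<le> b"
      using exponents_bounds p i by metis
    then have "0 \<le> 1 / a" "1 / b \<le> 1" by auto
    then have "0 \<le> 1 + 1 / a - 1 / b" by linarith
    then show ?thesis by (simp only: holder_const_def ab real_of_ereal.simps)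
  qed
  have "(\<Prod>i=1..m. \<integral>\<^sup>+y. ennreal \<bar>f i y\<bar> * indicator B y \<partial>M)
      \<le> (\<Prod>i=1..m. ennreal (holder_const M (p i)) * (?F i * ?n i))"
    using p ws f Bm(1)
    by (intro prod_mono_ennreal nn_integral_le_wnorm) (auto simp: weight_def Lspace_def)
  also have "\<dots> = ennreal (\<Prod>i=1..m. holder_const M (p i)) * ((\<Prod>i=1..m. ?F i) * (\<Prod>i=1..m. ?n i))"
    using prod_ennreal[OF K0, of "{1..m}" "\<lambda>i. i"] by (simp only: prod.distrib)
  finally have "weak_norm M q w (avg_op M m \<eta> B f) \<le>
      ?c * (ennreal (\<Prod>i=1..m. holder_const M (p i)) * ((\<Prod>i=1..m. ?F i) * (\<Prod>i=1..m. ?n i)))"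
    unfolding weak_norm_avg_op[OF Bm] by (rule mult_left_mono) simp
  also have "\<dots> = ennreal (\<Prod>i=1..m. holder_const M (p i)) * (?c * (\<Prod>i=1..m. ?n i)) * (\<Prod>i=1..m. ?F i)"
    by (simp only: ac_simps)
  also have "\<dots> \<le> ennreal (\<Prod>i=1..m. holder_const M (p i)) * A_const X d M m \<eta> p q ws w * (\<Prod>i=1..m. ?F i)"
    unfolding A_const_def using B by (intro mult_right_mono mult_left_mono SUP_upper) auto
  finally show "weak_norm M q w (avg_op M m \<eta> B f) \<le>
      ennreal (\<Prod>i=1..m. holder_const M (p i)) * A_const X d M m \<eta> p q ws w * (\<Prod>i=1..m. ?F i)" .
qed

lemma A_term_le_avg_op_bound:
  assumes X: "homogeneous_type X d M" and p: "\<forall>i\<in>{1..m}. p i \<in> exponents M"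
    and ws: "\<forall>i\<in>{1..m}. weight X d M (ws i)" and B: "B \<in> qballs X d"
    and N: "avg_op_bound M m \<eta> p q ws w B N"
  shows "ennreal (measure M B powr (\<eta> - real m)) * vnorm M q (\<lambda>x. w x * indicator B x) *
    (\<Prod>i=1..m. vnorm M (conj_exp (p i)) (\<lambda>x. inverse (ws i x) * indicator B x)) \<le> N"
proof (rule mult_prod_le_of_approx)
  note Bm = qball_measure[OF X B]
  fix a :: "nat \<Rightarrow> real"
  assume a: "\<forall>i\<in>{1..m}. 0 \<le> a i \<and>
    (a i = 0 \<or> ennreal (a i) < vnorm M (conj_exp (p i)) (\<lambda>x. inverse (ws i x) * indicator B x))"
  have "\<exists>f. f \<in> Lspace M (p i) (ws i) \<and> wnorm M (p i) (ws i) (\<lambda>x. ennreal \<bar>f x\<bar>) \<le> 1 \<and>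
      ennreal (a i) \<le> (\<integral>\<^sup>+x. ennreal \<bar>f x\<bar> * indicator B x \<partial>M)" if i: "i \<in> {1..m}" for i
  proof -
    have "p i \<in> exponents M" "ws i \<in> borel_measurable M" "AE x in M. 0 < ws i x \<and> ws i x < \<infinity>"
      "0 \<le> a i" "a i = 0 \<or> ennreal (a i) < vnorm M (conj_exp (p i)) (\<lambda>x. inverse (ws i x) * indicator B x)"
      using p ws a i unfolding weight_def by blast+
    from Lspace_near_dual[OF this(1) Bm(1,3) this(2-)] show ?thesis by metis
  qed
  then obtain f where f: "\<And>i. i \<in> {1..m} \<Longrightarrow> f i \<in> Lspace M (p i) (ws i)"
      "\<And>i. i \<in> {1..m} \<Longrightarrow> wnorm M (p i) (ws i) (\<lambda>x. ennreal \<bar>f i x\<bar>) \<le> 1"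
      "\<And>i. i \<in> {1..m} \<Longrightarrow> ennreal (a i) \<le> (\<integral>\<^sup>+x. ennreal \<bar>f i x\<bar> * indicator B x \<partial>M)"
    by metis
  have "ennreal (measure M B powr (\<eta> - real m)) * vnorm M q (\<lambda>x. w x * indicator B x) *
      (\<Prod>i=1..m. ennreal (a i)) \<le> weak_norm M q w (avg_op M m \<eta> B f)"
    unfolding weak_norm_avg_op[OF Bm] using f(3) by (intro mult_left_mono prod_mono_ennreal) auto
  also have "\<dots> \<le> N * (\<Prod>i=1..m. wnorm M (p i) (ws i) (\<lambda>x. ennreal \<bar>f i x\<bar>))"
    using N f(1) unfolding avg_op_bound_def by blast
  also have "\<dots> \<le> N * (\<Prod>i=1..m. 1)"
    using f(2) by (intro mult_left_mono prod_mono_ennreal) auto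
  finally show "ennreal (measure M B powr (\<eta> - real m)) * vnorm M q (\<lambda>x. w x * indicator B x) *
      (\<Prod>i=1..m. ennreal (a i)) \<le> N" by simp
qed simp

theorem theorem1p13:
  fixes X :: "'a set" and d :: "'a \<Rightarrow> 'a \<Rightarrow> real" and M :: "'a measure"
    and m :: nat and \<eta> :: real
    and p :: "nat \<Rightarrow> 'a \<Rightarrow> real" and ps q :: "'a \<Rightarrow> real"
  assumes "homogeneous_type X d M"
    and "m \<ge> 1"
    and "\<forall>i\<in>{1..m}. p i \<in> exponents M"
    and "\<forall>x\<in>X. 1 / ps x = (\<Sum>i=1..m. 1 / p i x)"
    and "q \<in> exponents0 M"
    and "0 \<le> \<eta>" "\<eta> < real m"
    and "\<forall>x\<in>X. 1 / ps x - 1 / q x = \<eta>"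
  shows "\<exists>C>0. \<forall>(ws :: nat \<Rightarrow> 'a \<Rightarrow> ennreal) (w :: 'a \<Rightarrow> ennreal).
     (\<forall>i\<in>{1..m}. weight X d M (ws i)) \<and> weight X d M w \<longrightarrow>
       (uniformly_bounded_avg_ops X d M m \<eta> p q ws w \<longleftrightarrow> A_class X d M m \<eta> p q ws w) \<and>
       A_const X d M m \<eta> p q ws w \<le>
         ennreal C * (SUP B\<in>qballs X d. avg_op_norm M m \<eta> p q ws w B) \<and>
       (SUP B\<in>qballs X d. avg_op_norm M m \<eta> p q ws w B) \<le>
         ennreal (\<Prod>i=1..m. holder_const M (p i)) * A_const X d M m \<eta> p q ws w"
proof (intro exI[of _ 1] conjI allI impI)
  note X = assms(1) and p = assms(3)
  fix ws :: "nat \<Rightarrow> 'a \<Rightarrow> ennreal" and w :: "'a \<Rightarrow> ennreal"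
  assume "(\<forall>i\<in>{1..m}. weight X d M (ws i)) \<and> weight X d M w"
  then have ws: "\<forall>i\<in>{1..m}. weight X d M (ws i)" by blast
  let ?A = "A_const X d M m \<eta> p q ws w"
  let ?K = "\<Prod>i=1..m. holder_const M (p i)"
  show lower: "?A \<le> ennreal 1 * (SUP B\<in>qballs X d. avg_op_norm M m \<eta> p q ws w B)"
    unfolding A_const_def ennreal_1 mult_1
  proof (rule SUP_mono)
    fix B assume B: "B \<in> qballs X d"
    show "\<exists>B'\<in>qballs X d. ennreal (measure M B powr (\<eta> - real m)) *
        vnorm M q (\<lambda>x. w x * indicator B x) *
        (\<Prod>i=1..m. vnorm M (conj_exp (p i)) (\<lambda>x. inverse (ws i x) * indicator B x))
        \<le> avg_op_norm M m \<eta> p q ws w B'"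
      unfolding avg_op_norm_def using A_term_le_avg_op_bound[OF X p ws B] B
      by (intro bexI[of _ B] Inf_greatest) auto
  qed
  show "(SUP B\<in>qballs X d. avg_op_norm M m \<eta> p q ws w B) \<le> ennreal ?K * ?A"
    unfolding avg_op_norm_def using avg_op_bound_A_const[OF X p ws]
    by (intro SUP_least Inf_lower) auto
  show "uniformly_bounded_avg_ops X d M m \<eta> p q ws w \<longleftrightarrow> A_class X d M m \<eta> p q ws w"
  proof
    assume "uniformly_bounded_avg_ops X d M m \<eta> p q ws w"
    then obtain C where C: "\<And>B. B \<in> qballs X d \<Longrightarrow> avg_op_bound M m \<eta> p q ws w B (ennreal C)"
      unfolding uniformly_bounded_avg_ops_def by blast
    have "?A \<le> ennreal C"
      unfolding A_const_def using A_term_le_avg_op_bound[OF X p ws _ C] by (intro SUP_least) auto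
    then show "A_class X d M m \<eta> p q ws w"
      unfolding A_class_def by (rule le_less_trans) simp
  next
    assume "A_class X d M m \<eta> p q ws w"
    then have "ennreal ?K * ?A < top"
      by (simp add: A_class_def ennreal_mult_less_top)
    then have "ennreal (enn2real (ennreal ?K * ?A)) = ennreal ?K * ?A"
      by simp
    then show "uniformly_bounded_avg_ops X d M m \<eta> p q ws w"
      unfolding uniformly_bounded_avg_ops_def using avg_op_bound_A_const[OF X p ws] by metis
  qed
qed simp

end
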